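(* Let $\lambda\in\mathbb{C}$. Let $\mathbf{R}(\lambda):\mathbb{C}^3\to\mathbb{C}^3$ be the rational map $$\mathbf{R}(\lambda):(x_1,x_2,x_3)\mapsto\left(\frac{x_1x_2}{x_1+x_3+\lambda x_1x_2x_3},\;x_1+x_3+\lambda x_1x_2x_3,\;\frac{x_2x_3}{x_1+x_3+\lambda x_1x_2x_3}\right),$$ and let $\mathbf{J}(\lambda):\mathbb{C}^4\to\mathbb{C}^4$ be the rational map $$\mathbf{J}(\lambda):(x_1,x_2,x_3,x_4)\mapsto\left(\frac{x_1x_2^2x_3}{y_1},\;\frac{y_1}{y_2},\;\frac{y_2^2}{y_1},\;\frac{x_2x_3x_4}{y_2}\right),$$ where $y_1=x_1(x_2+x_4)(x_2+x_4+2\lambda x_2x_3x_4)+x_3x_4^2$ and $y_2=x_1(x_2+x_4+2\lambda x_2x_3x_4)+x_3x_4$. Then, as rational maps in nine generic variables $(x_1,\dots,x_9)\in\mathbb{C}^9$, $$\mathbf{R}(\lambda)_{489}\mathbf{J}(\lambda)_{3579}\mathbf{R}(\lambda)_{269}\mathbf{R}(\lambda)_{258}\mathbf{J}(\lambda)_{1678}\mathbf{J}(\lambda)_{1234}\mathbf{R}(\lambda)_{456}=\mathbf{R}(\lambda)_{456}\mathbf{J}(\lambda)_{1234}\mathbf{J}(\lambda)_{1678}\mathbf{R}(\lambda)_{258}\mathbf{R}(\lambda)_{269}\mathbf{J}(\lambda)_{3579}\mathbf{R}(\lambda)_{489}.$$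
   Context: Products of maps denote composition (the rightmost map is applied first). For $i<j<k$, $\mathbf{R}(\lambda)_{ijk}$ acts as $\mathbf{R}(\lambda)$ on components $(x_i,x_j,x_k)$ of $(x_1,\dots,x_9)$ and as the identity on the other components; for $i<j<k<l$, $\mathbf{J}(\lambda)_{ijkl}$ acts as $\mathbf{J}(\lambda)$ on components $(x_i,x_j,x_k,x_l)$ and as the identity on the others. All variables are assumed generic: the equation is an identity of (compositions of) rational maps. *)

theory Defs
  imports "HOL-Analysis.Analysis"
begin

inductive poly_fun :: "(complex ^ 'n \<Rightarrow> complex) \<Rightarrow> bool" where
  const: "poly_fun (\<lambda>x. c)"
| coord: "poly_fun (\<lambda>x. x $ i)"
| add: "poly_fun p \<Longrightarrow> poly_fun q \<Longrightarrow> poly_fun (\<lambda>x. p x + q x)"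
| mult: "poly_fun p \<Longrightarrow> poly_fun q \<Longrightarrow> poly_fun (\<lambda>x. p x * q x)"

definition zariski_open :: "(complex ^ 'n) set \<Rightarrow> bool" where
  "zariski_open U \<longleftrightarrow>
     (\<exists>P. (\<forall>p\<in>P. poly_fun p) \<and> U = {x. \<exists>p\<in>P. p x \<noteq> 0})"

text \<open>
  A rational map is represented by a partial function whose domain is the set where the
  denominators of the given formula do not vanish; composition is that of partial functions,
  \<open>f \<circ>\<^sub>m g\<close>, with \<open>g\<close> applied first. Two representatives are identified when they are both
  defined and agree on a nonempty Zariski open set; affine space is irreducible, so such a
  set is dense. In particular \<open>rational_eq f g\<close> fails if \<open>f\<close> or \<open>g\<close> is generically undefined.
\<close>

definition rational_eq ::
  "(complex ^ 'm \<rightharpoonup> complex ^ 'n) \<Rightarrow> (complex ^ 'm \<rightharpoonup> complex ^ 'n) \<Rightarrow> bool" where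
  "rational_eq f g \<longleftrightarrow>
     (\<exists>U. zariski_open U \<and> U \<noteq> {} \<and> U \<subseteq> dom f \<inter> dom g \<and> (\<forall>x\<in>U. f x = g x))"

definition R :: "complex \<Rightarrow> (complex ^ 3 \<rightharpoonup> complex ^ 3)" where
  "R l x =
     (let d = x$1 + x$3 + l * x$1 * x$2 * x$3
      in if d = 0 then None
         else Some (vector [x$1 * x$2 / d, d, x$2 * x$3 / d]))"

definition J :: "complex \<Rightarrow> (complex ^ 4 \<rightharpoonup> complex ^ 4)" where
  "J l x =
     (let y1 = x$1 * (x$2 + x$4) * (x$2 + x$4 + 2 * l * x$2 * x$3 * x$4) + x$3 * (x$4)^2;
          y2 = x$1 * (x$2 + x$4 + 2 * l * x$2 * x$3 * x$4) + x$3 * x$4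
      in if y1 = 0 \<or> y2 = 0 then None
         else Some (vector [x$1 * (x$2)^2 * x$3 / y1, y1 / y2, y2^2 / y1,
                            x$2 * x$3 * x$4 / y2]))"

text \<open>
  \<open>act_on e f\<close> lets \<open>f\<close> act on the components \<open>e 1, e 2, \<dots>\<close> and fixes all other components.
  It is only meaningful for injective \<open>e\<close>.
\<close>

definition act_on ::
  "('m \<Rightarrow> 'n) \<Rightarrow> (complex ^ 'm \<rightharpoonup> complex ^ 'm) \<Rightarrow> (complex ^ 'n \<rightharpoonup> complex ^ 'n)" where
  "act_on e f x =
     map_option (\<lambda>y. \<chi> k. if k \<in> range e then y $ (inv e k) else x $ k) (f (\<chi> i. x $ (e i)))"

text \<open>
  The nine components are indexed by the type \<open>9\<close>, whose elements are the distinct numerals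
  \<open>1, \<dots>, 9\<close>; arithmetic in it is modulo nine, so \<open>9 = 0\<close> is the index of the last component.
  Likewise \<open>3 = 0\<close> in the index type \<open>3\<close> and \<open>4 = 0\<close> in the index type \<open>4\<close>.
\<close>

definition R_at :: "9 \<Rightarrow> 9 \<Rightarrow> 9 \<Rightarrow> complex \<Rightarrow> (complex ^ 9 \<rightharpoonup> complex ^ 9)" where
  "R_at i j k l = act_on (($) (vector [i, j, k])) (R l)"

definition J_at :: "9 \<Rightarrow> 9 \<Rightarrow> 9 \<Rightarrow> 9 \<Rightarrow> complex \<Rightarrow> (complex ^ 9 \<rightharpoonup> complex ^ 9)" where
  "J_at i j k m l = act_on (($) (vector [i, j, k, m])) (J l)"

end

theory Submission
  imports Defs
begin

text \<open>
  On either route from \<open>x\<close> to the common image, every component of every intermediate state is a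
  quotient of monomials in the coordinates and in finitely many polynomials of \<open>x\<close>, because in
  the denominator arising at each step large factors cancel. The left route produces the
  polynomials \<open>p1, \<dots>, p7\<close> and then \<open>q6, q7, q4\<close>; the right route produces \<open>q1, \<dots>, q7\<close> and then
  \<open>p7, p5, p6\<close>. Once each cancellation is written as a polynomial identity, both routes visibly end
  in the same state. All this is valid where the coordinates and the polynomials are nonzero,
  which is a Zariski open set containing a point of the form \<open>(1, c, 1, 1, c, 1, 1, c, 1)\<close>.
\<close>

lemma forall_9:
  "(\<forall>i::9. P i) \<longleftrightarrow> P 1 \<and> P 2 \<and> P 3 \<and> P 4 \<and> P 5 \<and> P 6 \<and> P 7 \<and> P 8 \<and> P 9"
proof -
  have "i \<in> {1, 2, 3, 4, 5, 6, 7, 8, 9}" for i :: 9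
  proof (induct i)
    case (of_int z)
    \<comment> \<open>Representatives modulo nine run from 0 to 8; the index \<open>9\<close> is
      represented by 0.\<close>
    then have "z \<in> {0, 1, 2, 3, 4, 5, 6, 7, 8}"
      by auto
    then show ?case
      by auto
  qed
  then show ?thesis
    by (metis insertE empty_iff)
qed

lemma vector_4:
  "(vector [a, b, c, d] :: ('a::zero)^4) $ 1 = a"
  "(vector [a, b, c, d] :: 'a^4) $ 2 = b"
  "(vector [a, b, c, d] :: 'a^4) $ 3 = c"
  "(vector [a, b, c, d] :: 'a^4) $ 4 = d"
  unfolding vector_def by simp_all

lemma vector_9:
  fixes a1 a2 a3 a4 a5 a6 a7 a8 a9 :: "'a::zero"
  defines "v \<equiv> vector [a1, a2, a3, a4, a5, a6, a7, a8, a9] :: 'a^9"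
  shows "v $ 1 = a1" "v $ 2 = a2" "v $ 3 = a3" "v $ 4 = a4" "v $ 5 = a5" "v $ 6 = a6"
    "v $ 7 = a7" "v $ 8 = a8" "v $ 9 = a9"
  unfolding v_def vector_def by simp_all

section \<open>Criteria for the value of a single factor\<close>

lemma act_on_eq_Some:
  assumes "inj e" and "f (\<chi> i. x $ e i) = Some z"
    and "\<And>i. y $ e i = z $ i" and "\<And>n. n \<notin> range e \<Longrightarrow> y $ n = x $ n"
  shows "act_on e f x = Some y"
  using assms by (auto simp: act_on_def vec_eq_iff)

text \<open>The candidate output \<open>y\<close> is supplied in advance. Its component
  \<open>j\<close> must equal the denominator of \<open>R\<close>, so the two quotients can be
  checked as products.\<close>

lemma R_at_eq_Some:
  fixes i j k :: 9
  assumes ne: "distinct [i, j, k]"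
    and d: "x$i + x$k + l * x$i * x$j * x$k = y$j" "y$j \<noteq> 0"
    and out: "x$i * x$j = y$i * y$j" "x$j * x$k = y$k * y$j"
    and rest: "\<forall>n. n \<in> {i, j, k} \<or> y$n = x$n"
  shows "R_at i j k l x = Some y"
  unfolding R_at_def
proof (rule act_on_eq_Some)
  let ?e = "($) (vector [i, j, k] :: 9^3)"
  show "inj ?e"
    using ne by (auto simp: inj_def forall_3)
  show "R l (\<chi> n. x $ ?e n) = Some (vector [y$i, y$j, y$k])"
    using d out by (simp add: R_def)
  show "y $ ?e n = (vector [y$i, y$j, y$k] :: complex^3) $ n" for n
    using exhaust_3[of n] by auto
  show "y $ n = x $ n" if "n \<notin> range ?e" for n
  proof -
    have "range ?e = {i, j, k}"
      by (simp add: UNIV_3)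
    with that rest show ?thesis
      by blast
  qed
qed

text \<open>
  The denominators of \<open>J\<close> satisfy \<open>y1 = (x2 + x4) y2 - x2 x3 x4\<close>, so \<open>y1\<close> is linear in \<open>y2\<close>;
  this keeps the polynomial identities below small. From the output they are recovered as
  \<open>y2 = y$j * y$k\<close> and \<open>y1 = y$j * y$j * y$k\<close>.
\<close>

lemma J_at_eq_Some:
  fixes i j k m :: 9
  assumes ne: "distinct [i, j, k, m]"
    and y2: "x$i * (x$j + x$m + 2 * l * x$j * x$k * x$m) + x$k * x$m = y$j * y$k"
    and y1: "(x$j + x$m) * (y$j * y$k) - x$j * x$k * x$m = y$j * y$j * y$k"
    and nz: "y$j \<noteq> 0" "y$k \<noteq> 0"
    and out: "x$i * x$j * x$j * x$k = y$i * y$j * y$j * y$k" "x$j * x$k * x$m = y$m * y$j * y$k"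
    and rest: "\<forall>n. n \<in> {i, j, k, m} \<or> y$n = x$n"
  shows "J_at i j k m l x = Some y"
  unfolding J_at_def
proof (rule act_on_eq_Some)
  let ?e = "($) (vector [i, j, k, m] :: 9^4)"
  show "inj ?e"
    using ne by (auto simp: inj_def forall_4 vector_4)
  have "x$i * (x$j + x$m) * (x$j + x$m + 2 * l * x$j * x$k * x$m) + x$k * (x$m)\<^sup>2
      = (x$j + x$m) * (x$i * (x$j + x$m + 2 * l * x$j * x$k * x$m) + x$k * x$m) - x$j * x$k * x$m"
    by (simp add: algebra_simps power2_eq_square)
  also have "\<dots> = y$j * y$j * y$k"
    using y1 y2 by simp
  finally have y1': "x$i * (x$j + x$m) * (x$j + x$m + 2 * l * x$j * x$k * x$m) + x$k * (x$m)\<^sup>2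
      = y$j * y$j * y$k" .
  have out1: "x$i * (x$j)\<^sup>2 * x$k = y$i * (y$j * y$j * y$k)"
    using out by (simp add: power2_eq_square mult.assoc)
  show "J l (\<chi> n. x $ ?e n) = Some (vector [y$i, y$j, y$k, y$m])"
    unfolding J_def Let_def using nz out
    by (simp add: vector_4 y1' y2 out1 power2_eq_square[of "y$j * y$k"])
  show "y $ ?e n = (vector [y$i, y$j, y$k, y$m] :: complex^4) $ n" for n
    using exhaust_4[of n] by (auto simp: vector_4)
  show "y $ n = x $ n" if "n \<notin> range ?e" for n
  proof -
    have "range ?e = {i, j, k, m}"
      by (simp add: UNIV_4 vector_4)
    with that rest show ?thesis
      by blast
  qed
qed

section \<open>Polynomials arising along the two routes\<close>

context
  fixes l x1 x2 x3 x4 x5 x6 x7 x8 x9 :: complex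
begin

text \<open>Up to \<open>R_at 2 6 9\<close>, the denominators on the left route are
  \<open>p1\<close>; \<open>p2 / p1\<close> and \<open>p3 / p1^2\<close>; \<open>p4 / p3\<close> and
  \<open>p5 / p3\<close>; \<open>p3 * p6 / (p2 * p4)\<close>; \<open>p7 / p6\<close>. Pairs are y2
  and y1 of a \<open>J\<close>.\<close>

definition "p1 = x4 + x6 + l * x4 * x5 * x6"
definition "p2 = x1 * x2 * p1 + x1 * x4 * x5 + 2 * l * x1 * x2 * x3 * x4 * x5 + x3 * x4 * x5"
definition "p3 = p2 * (x2 * p1 + x4 * x5) - x2 * x3 * x4 * x5 * p1"
definition "p4 = x1 * x2\<^sup>2 * x3 * p1 * (x5 * x6 + x8 * p1 + 2 * l * x5 * x6 * x7 * x8)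
    + x7 * x8 * p3"
definition "p5 = x1 * x2\<^sup>2 * x3 * (x5 * x6 + x8 * p1)
      * (x5 * x6 + x8 * p1 + 2 * l * x5 * x6 * x7 * x8) + x7 * x8\<^sup>2 * p3"
definition "p6 = x1 * x2\<^sup>2 * x3 * (x5 * x6 + x8 * p1 + 2 * l * x5 * x6 * x7 * x8)
    + x7 * x8 * (p2 * (x2 + x5 + l * x2 * x5 * x6) - x2 * x3 * x4 * x5 * (1 + l * x5 * x6))"
definition "p7 = p4 + x9 * p6 + l * x9 * p5"
text \<open>The right route begins with the denominators \<open>q1\<close>; \<open>q2 / q1\<close>
  and \<open>q3 / q1^2\<close>; \<open>q4 / q2\<close>; \<open>q5 / q4\<close>.\<close>

definition "q1 = x4 + x9 + l * x4 * x8 * x9"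
definition "q2 = x3 * x5 * q1 + x3 * x8 * x9 + 2 * l * x3 * x5 * x7 * x8 * x9 + x7 * x8 * x9"
definition "q3 = q2 * (x5 * q1 + x8 * x9) - x5 * x7 * x8 * x9 * q1"
definition "q4 = x2 * q2 + x5 * x7 * x8 * x9 * (1 + l * x2 * x6)"
definition "q5 = x2 * x6 * q2 + q4 * q1 + l * x2 * x6 * q3"

text \<open>\<open>qb\<close> is the polynomial \<open>(q3 + q5) / q2\<close>; it gives \<open>q6\<close> and \<open>q7\<close> without division.\<close>

definition "qb = (1 + l * x2 * x6) * (x5 * q1 + x8 * x9) + x2 * (x6 + q1)"
definition "q6 = x1 * (qb + 2 * l * q4) + q2"
definition "q7 = q6 * qb - q5"

section \<open>Cancellations in the denominators\<close>

lemma p1_p6: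
  "p1 * p6 = p4 + x5 * x6 * x7 * x8 * p2 + l * x5 * x6 * x7 * x8 * p3"
  unfolding p4_def p3_def p6_def p2_def p1_def
  by algebra

lemma p1_p5:
  "p1 * p5 = x5 * x6 * p4 + x8 * p1 * p4 - x5 * x6 * x7 * x8 * p3"
  unfolding p4_def p5_def p3_def p2_def p1_def
  by algebra

text \<open>Here the left route meets the polynomials of the right one: in
  \<open>J_at 3 5 7 9\<close> the factor \<open>p3 * p4\<close> cancels from y2, leaving
  \<open>p6 * q6 / p7\<close>.\<close>

lemma p3_p4_q6:
  "p3 * p4 * q6 = p2 * p3 * p7 + x9 * p2\<^sup>2 * p5 + 2 * l * x9 * p2 * p4 * p6
    + x9 * p4\<^sup>2"
  unfolding p7_def p5_def p6_def q6_def q4_def q2_def qb_def q1_def p4_def p3_def p2_def p1_def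
  by algebra

lemma p2_p4_q7:
  "p2 * p4 * q7 = p3 * p7 * q6 + x9 * p2 * p5 * q6 - x9 * p4 * p7"
  unfolding p7_def p5_def p6_def q7_def q5_def q3_def q6_def q4_def q2_def qb_def q1_def p4_def
    p3_def p2_def p1_def
  by algebra

lemma p2_q4:
  "p2 * q4 = x2 * x3 * x4 * x5 * q6 + x9 * p6
    + l * x2 * x3 * x4 * x5\<^sup>2 * x6 * x7 * x8 * x9"
  unfolding p6_def q6_def qb_def q4_def q2_def q1_def p2_def p1_def
  by algebra

text \<open>In \<open>J_at 1 6 7 8\<close> on the right route \<open>q2\<close> cancels, leaving y2
  = \<open>q4 * q6 / q5\<close>.\<close>

lemma q2_q6:
  "q6 * q2 = x1 * q5 + x1 * q3 + 2 * l * x1 * q4 * q2 + q2\<^sup>2"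
  unfolding q5_def q3_def q6_def q4_def q2_def qb_def q1_def
  by algebra

lemma q2_q7:
  "q7 * q2 = q6 * q5 + q6 * q3 - q2 * q5"
  unfolding q7_def q5_def q3_def q6_def q4_def q2_def qb_def q1_def
  by algebra

text \<open>The right route now meets \<open>p7\<close>: in \<open>J_at 1 2 3 4\<close> the factor
  \<open>q1 * q3\<close> cancels from y2, leaving \<open>p7 / q7\<close>.\<close>

lemma q1_q3_p7:
  "p7 * q1 * q3 = x1 * x2 * x6 * q3 * q5 + x1 * x4 * x8 * q5\<^sup>2
    + 2 * l * x1 * x2 * x3 * x4 * x5\<^sup>2 * x6 * x7 * x8 * q1 * q5
    + x3 * x4 * x5\<^sup>2 * x7 * x8 * q7 * q1\<^sup>2"
  unfolding q7_def q6_def qb_def q5_def q4_def q3_def q2_def q1_def p7_def p5_def p6_def p4_def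
    p3_def p2_def p1_def
  by algebra

lemma q1_q5_p5:
  "p5 * q1 * q5 = x2 * x6 * p7 * q3 + x4 * x8 * p7 * q5
    - x2 * x3 * x4 * x5\<^sup>2 * x6 * x7 * x8 * q7 * q1"
  unfolding q7_def q6_def qb_def p7_def p6_def p4_def q5_def q3_def q4_def q2_def q1_def p5_def
    p3_def p2_def p1_def
  by algebra

lemma q5_p6:
  "p6 * q5 = x2 * x3 * x4 * x5\<^sup>2 * x6 * x7 * x8 * q6 + p7 * q4
    + l * x2 * x3 * x4 * x5\<^sup>2 * x6 * x7 * x8 * q7"
  unfolding q7_def p7_def p5_def p4_def p3_def q6_def qb_def q5_def q3_def q4_def q2_def q1_def
    p6_def p2_def p1_def
  by algebra

section \<open>Both routes from a nondegenerate point\<close>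

definition "nondegenerate = x1 * x2 * x3 * x4 * x5 * x6 * x7 * x8 * x9
    * p1 * p2 * p3 * p4 * p5 * p6 * p7 * q1 * q2 * q3 * q4 * q5 * q6 * q7"

definition "start = (vector [x1, x2, x3, x4, x5, x6, x7, x8, x9] :: complex^9)"

definition "final =
  (vector [x1 * x2 * x2 * x3 * x5 * x5 * x6 * x6 * x7 / p5, p5 / p7, p7 * p7 / (p5 * q7),
        x2 * x3 * x4 * x5 * x5 * x6 * x7 * x8 * q6 / (p6 * q4), p6 * q7 / (p7 * q6), p7 / p6,
        q6 * q6 / q7, q4 / q6, x5 * x6 * x7 * x8 * x9 / q4] :: complex^9)"

context
  assumes nondegenerate: "nondegenerate \<noteq> 0"
begin

lemma nonzero:
  "x1 \<noteq> 0" "x2 \<noteq> 0" "x3 \<noteq> 0" "x4 \<noteq> 0" "x5 \<noteq> 0"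
  "x6 \<noteq> 0" "x7 \<noteq> 0" "x8 \<noteq> 0" "x9 \<noteq> 0"
  "p1 \<noteq> 0" "p2 \<noteq> 0" "p3 \<noteq> 0" "p4 \<noteq> 0" "p5 \<noteq> 0" "p6 \<noteq> 0" "p7 \<noteq> 0"
  "q1 \<noteq> 0" "q2 \<noteq> 0" "q3 \<noteq> 0" "q4 \<noteq> 0" "q5 \<noteq> 0" "q6 \<noteq> 0" "q7 \<noteq> 0"
  using nondegenerate by (simp_all add: nondegenerate_def)

lemma left_route:
  "(R_at 4 8 9 l \<circ>\<^sub>m J_at 3 5 7 9 l \<circ>\<^sub>m R_at 2 6 9 l \<circ>\<^sub>m R_at 2 5 8 l \<circ>\<^sub>m
      J_at 1 6 7 8 l \<circ>\<^sub>m J_at 1 2 3 4 l \<circ>\<^sub>m R_at 4 5 6 l) start = Some final"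
proof -
  let ?s1 = "vector [x1, x2, x3, x4 * x5 / p1, p1, x5 * x6 / p1, x7, x8, x9] :: complex^9"
  let ?s2 = "vector [x1 * x2 * x2 * x3 * p1 * p1 / p3, p3 / (p1 * p2), p2 * p2 / p3,
        x2 * x3 * x4 * x5 / p2, p1, x5 * x6 / p1, x7, x8, x9] :: complex^9"
  let ?s3 = "vector [x1 * x2 * x2 * x3 * x5 * x5 * x6 * x6 * x7 / p5, p3 / (p1 * p2), p2 * p2 / p3,
        x2 * x3 * x4 * x5 / p2, p1, p5 / p4, p4 * p4 / (p3 * p5),
        x5 * x6 * x7 * x8 * p3 / (p1 * p4), x9] :: complex^9"
  let ?s4 = "vector [x1 * x2 * x2 * x3 * x5 * x5 * x6 * x6 * x7 / p5, p4 / p6, p2 * p2 / p3,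
        x2 * x3 * x4 * x5 / p2, p3 * p6 / (p2 * p4), p5 / p4, p4 * p4 / (p3 * p5),
        x5 * x6 * x7 * x8 * p2 / p6, x9] :: complex^9"
  let ?s5 = "vector [x1 * x2 * x2 * x3 * x5 * x5 * x6 * x6 * x7 / p5, p5 / p7, p2 * p2 / p3,
        x2 * x3 * x4 * x5 / p2, p3 * p6 / (p2 * p4), p7 / p6, p4 * p4 / (p3 * p5),
        x5 * x6 * x7 * x8 * p2 / p6, x9 * p5 * p6 / (p4 * p7)] :: complex^9"
  let ?s6 = "vector [x1 * x2 * x2 * x3 * x5 * x5 * x6 * x6 * x7 / p5, p5 / p7, p7 * p7 / (p5 * q7),
        x2 * x3 * x4 * x5 / p2, p6 * q7 / (p7 * q6), p7 / p6, q6 * q6 / q7,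
        x5 * x6 * x7 * x8 * p2 / p6, x9 * p6 / (p2 * q6)] :: complex^9"
  \<comment> \<open>In each step simplification settles the monomial conditions. What remains is the
    denominator identity for \<open>R\<close>, or those for y2 and y1, in this order, for
    \<open>J\<close>.\<close>
  have s1: "R_at 4 5 6 l start = Some ?s1"
    by (rule R_at_eq_Some,
        simp_all add: vector_9 forall_9 nonzero divide_simps start_def,
        use p1_def in algebra)
  have s2: "J_at 1 2 3 4 l ?s1 = Some ?s2"
    by (rule J_at_eq_Some,
        simp_all add: vector_9 forall_9 nonzero divide_simps,
        use p2_def in algebra, use p3_def in algebra)
  have s3: "J_at 1 6 7 8 l ?s2 = Some ?s3"
    by (rule J_at_eq_Some,
        simp_all add: vector_9 forall_9 nonzero divide_simps,
        use p4_def in algebra, use p1_p5 in algebra)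
  have s4: "R_at 2 5 8 l ?s3 = Some ?s4"
    by (rule R_at_eq_Some,
        simp_all add: vector_9 forall_9 nonzero divide_simps,
        use p1_p6 in algebra)
  have s5: "R_at 2 6 9 l ?s4 = Some ?s5"
    by (rule R_at_eq_Some,
        simp_all add: vector_9 forall_9 nonzero divide_simps,
        use p7_def in algebra)
  have s6: "J_at 3 5 7 9 l ?s5 = Some ?s6"
    by (rule J_at_eq_Some,
        simp_all add: vector_9 forall_9 nonzero divide_simps,
        use p3_p4_q6 in algebra, use p2_p4_q7 in algebra)
  have s7: "R_at 4 8 9 l ?s6 = Some final"
    by (rule R_at_eq_Some,
        simp_all add: vector_9 forall_9 nonzero divide_simps final_def,
        use p2_q4 in algebra)
  show ?thesis
    using s1 s2 s3 s4 s5 s6 s7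
    by (simp add: map_comp_def)
qed

lemma right_route:
  "(R_at 4 5 6 l \<circ>\<^sub>m J_at 1 2 3 4 l \<circ>\<^sub>m J_at 1 6 7 8 l \<circ>\<^sub>m R_at 2 5 8 l \<circ>\<^sub>m
      R_at 2 6 9 l \<circ>\<^sub>m J_at 3 5 7 9 l \<circ>\<^sub>m R_at 4 8 9 l) start = Some final"
proof -
  let ?s1 = "vector [x1, x2, x3, x4 * x8 / q1, x5, x6, x7, q1, x8 * x9 / q1] :: complex^9"
  let ?s2 = "vector [x1, x2, x3 * x5 * x5 * x7 * q1 * q1 / q3, x4 * x8 / q1, q3 / (q1 * q2), x6,
        q2 * q2 / q3, q1, x5 * x7 * x8 * x9 / q2] :: complex^9"
  let ?s3 = "vector [x1, x2 * x6 * q2 / q4, x3 * x5 * x5 * x7 * q1 * q1 / q3, x4 * x8 / q1,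
        q3 / (q1 * q2), q4 / q2, q2 * q2 / q3, q1, x5 * x6 * x7 * x8 * x9 / q4] :: complex^9"
  let ?s4 = "vector [x1, x2 * x6 * q3 / (q1 * q5), x3 * x5 * x5 * x7 * q1 * q1 / q3, x4 * x8 / q1,
        q5 / q4, q4 / q2, q2 * q2 / q3, q4 * q3 / (q2 * q5), x5 * x6 * x7 * x8 * x9 / q4] :: complex^9"
  let ?s5 = "vector [x1 * q5 * q5 / (q7 * q3), x2 * x6 * q3 / (q1 * q5),
        x3 * x5 * x5 * x7 * q1 * q1 / q3, x4 * x8 / q1, q5 / q4, q7 * q4 / (q6 * q5), q6 * q6 / q7,
        q4 / q6, x5 * x6 * x7 * x8 * x9 / q4] :: complex^9"
  let ?s6 = "vector [x1 * x2 * x2 * x3 * x5 * x5 * x6 * x6 * x7 / p5, p5 / p7, p7 * p7 / (p5 * q7),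
        x2 * x3 * x4 * x5 * x5 * x6 * x7 * x8 * q7 / (p7 * q5), q5 / q4, q7 * q4 / (q6 * q5),
        q6 * q6 / q7, q4 / q6, x5 * x6 * x7 * x8 * x9 / q4] :: complex^9"
  have s1: "R_at 4 8 9 l start = Some ?s1"
    by (rule R_at_eq_Some,
        simp_all add: vector_9 forall_9 nonzero divide_simps start_def,
        use q1_def in algebra)
  have s2: "J_at 3 5 7 9 l ?s1 = Some ?s2"
    by (rule J_at_eq_Some,
        simp_all add: vector_9 forall_9 nonzero divide_simps,
        use q2_def in algebra, use q3_def in algebra)
  have s3: "R_at 2 6 9 l ?s2 = Some ?s3"
    by (rule R_at_eq_Some,
        simp_all add: vector_9 forall_9 nonzero divide_simps,
        use q4_def in algebra)
  have s4: "R_at 2 5 8 l ?s3 = Some ?s4"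
    by (rule R_at_eq_Some,
        simp_all add: vector_9 forall_9 nonzero divide_simps,
        use q5_def in algebra)
  have s5: "J_at 1 6 7 8 l ?s4 = Some ?s5"
    by (rule J_at_eq_Some,
        simp_all add: vector_9 forall_9 nonzero divide_simps,
        use q2_q6 in algebra, use q2_q7 in algebra)
  have s6: "J_at 1 2 3 4 l ?s5 = Some ?s6"
    by (rule J_at_eq_Some,
        simp_all add: vector_9 forall_9 nonzero divide_simps,
        use q1_q3_p7 in algebra, use q1_q5_p5 in algebra)
  have s7: "R_at 4 5 6 l ?s6 = Some final"
    by (rule R_at_eq_Some,
        simp_all add: vector_9 forall_9 nonzero divide_simps final_def,
        use q5_p6 in algebra)
  show ?thesis
    using s1 s2 s3 s4 s5 s6 s7
    by (simp add: map_comp_def)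
qed

end

end

section \<open>The nondegenerate points form a nonempty Zariski open set\<close>

lemmas tau_defs = p1_def p2_def p3_def p4_def p5_def p6_def p7_def
  q1_def q2_def q3_def q4_def q5_def qb_def q6_def q7_def

lemma poly_fun_diff:
  assumes "poly_fun p" "poly_fun q"
  shows "poly_fun (\<lambda>x. p x - q x)"
  using poly_fun.add[OF assms(1) poly_fun.mult[OF poly_fun.const[of "-1"] assms(2)]] by simp

lemma poly_fun_nondegenerate:
  "poly_fun (\<lambda>x :: complex^9.
    nondegenerate l (x$1) (x$2) (x$3) (x$4) (x$5) (x$6) (x$7) (x$8) (x$9))"
  unfolding nondegenerate_def tau_defs power2_eq_square
  by (intro poly_fun.intros poly_fun_diff)

text \<open>
  Giving the coordinates 2, 5, 8 weight 1, the others weight 0 and \<open>l\<close> weight -1 makes all the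
  polynomials homogeneous, so rescaling reduces any \<open>l\<close> to 0 or 1. There the polynomials have
  positive values at positive points.
\<close>

lemma nondegenerate_witness:
  assumes "c \<noteq> 0" and "l = 0 \<and> c = 1 \<or> l * c = 1"
  shows "nondegenerate l 1 c 1 1 c 1 1 c 1 \<noteq> 0"
  using assms(2)
proof
  assume "l = 0 \<and> c = 1"
  then show ?thesis
    by (simp add: nondegenerate_def tau_defs)
next
  assume "l * c = 1"
  with assms(1) have "l = 1 / c"
    by (simp add: field_simps)
  show ?thesis
    \<comment> \<open>By homogeneity every factor becomes a positive integer times a power of
      \<open>c\<close>.\<close>
    unfolding nondegenerate_def tau_defs power2_eq_square \<open>l = 1 / c\<close>
    using assms(1) by simp
qed

lemma zariski_open_nonzero:
  assumes "poly_fun p"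
  shows "zariski_open {x. p x \<noteq> 0}"
  unfolding zariski_open_def using assms by (intro exI[of _ "{p}"]) simp

theorem proposition3p3:
  fixes l :: complex
  shows "rational_eq
    (R_at 4 8 9 l \<circ>\<^sub>m J_at 3 5 7 9 l \<circ>\<^sub>m R_at 2 6 9 l \<circ>\<^sub>m R_at 2 5 8 l \<circ>\<^sub>m
       J_at 1 6 7 8 l \<circ>\<^sub>m J_at 1 2 3 4 l \<circ>\<^sub>m R_at 4 5 6 l)
    (R_at 4 5 6 l \<circ>\<^sub>m J_at 1 2 3 4 l \<circ>\<^sub>m J_at 1 6 7 8 l \<circ>\<^sub>m R_at 2 5 8 l \<circ>\<^sub>m
       R_at 2 6 9 l \<circ>\<^sub>m J_at 3 5 7 9 l \<circ>\<^sub>m R_at 4 8 9 l)" (is "rational_eq ?f ?g")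
proof -
  let ?n = "\<lambda>x :: complex^9. nondegenerate l (x$1) (x$2) (x$3) (x$4) (x$5) (x$6) (x$7) (x$8) (x$9)"
  have agree: "\<exists>y. ?f x = Some y \<and> ?g x = Some y" if "?n x \<noteq> 0" for x
  proof -
    have "start (x$1) (x$2) (x$3) (x$4) (x$5) (x$6) (x$7) (x$8) (x$9) = x"
      by (simp add: start_def vec_eq_iff forall_9 vector_9)
    then show ?thesis
      using left_route[OF that] right_route[OF that] by simp
  qed
  obtain c where "c \<noteq> 0" "l = 0 \<and> c = 1 \<or> l * c = 1"
    by (cases "l = 0") (auto intro: that[of "1 / l"])
  then have "?n (vector [1, c, 1, 1, c, 1, 1, c, 1]) \<noteq> 0"
    using nondegenerate_witness by (simp add: vector_9)
  then have "{x. ?n x \<noteq> 0} \<noteq> {}"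
    by blast
  moreover have "x \<in> dom ?f \<inter> dom ?g" "?f x = ?g x" if "?n x \<noteq> 0" for x
    using agree[OF that] by auto
  then have "{x. ?n x \<noteq> 0} \<subseteq> dom ?f \<inter> dom ?g" "\<forall>x\<in>{x. ?n x \<noteq> 0}. ?f x = ?g x"
    by blast+
  ultimately show ?thesis
    unfolding rational_eq_def
    using zariski_open_nonzero[OF poly_fun_nondegenerate]
    by (intro exI[of _ "{x. ?n x \<noteq> 0}"] conjI)
qed

end
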